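(* Let $\mathcal{A}=(a_{i_1\cdots i_k})\in\mathbb{R}^{n_1\times\cdots\times n_k}$ with $n_1\ge 2$, and for $i\in[n_1]$ let $(\mathcal{A})^{(1)}_i\in\mathbb{R}^{n_2\times\cdots\times n_k}$ be the subtensor obtained by fixing the first index equal to $i$, so that $\mathcal{A}=((\mathcal{A})^{(1)}_1,\ldots,(\mathcal{A})^{(1)}_{n_1})$. Let $\mathcal{A}_1=((\mathcal{A})^{(1)}_1,\ldots,(\mathcal{A})^{(1)}_{n_1-1})\in\mathbb{R}^{(n_1-1)\times n_2\times\cdots\times n_k}$ (i.e. $\mathcal{A}$ with the last slice along the first index deleted). (1) If $(\mathcal{A})^{(1)}_{n_1}=0$, then ${\rm mr}(\mathcal{A})={\rm mr}(\mathcal{A}_1)$ and ${\rm Mr}(\mathcal{A})={\rm Mr}(\mathcal{A}_1)$. (2) If ${\rm sgn}((\mathcal{A})^{(1)}_{n_1})=c\,{\rm sgn}((\mathcal{A})^{(1)}_{l})$ for some $l\in[n_1-1]$ and $c\in\{1,-1\}$, then ${\rm mr}(\mathcal{A})={\rm mr}(\mathcal{A}_1)$.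
   Context: For a real tensor $\mathcal{A}$, ${\rm sgn}(\mathcal{A})$ is the entrywise sign tensor and $\mathcal{Q}(\mathcal{A})=\{\hat{\mathcal{A}}:{\rm sgn}(\hat{\mathcal{A}})={\rm sgn}(\mathcal{A})\}$. A rank one tensor is $\alpha_1\otimes\cdots\otimes\alpha_k$ with nonzero vectors $\alpha_j$, entries $(\alpha_1)_{i_1}\cdots(\alpha_k)_{i_k}$; ${\rm rank}(\mathcal{A})$ is the smallest number of rank one tensors summing to $\mathcal{A}$. ${\rm mr}(\mathcal{A})=\min\{{\rm rank}(\mathcal{B}):\mathcal{B}\in\mathcal{Q}(\mathcal{A})\}$, ${\rm Mr}(\mathcal{A})=\max\{{\rm rank}(\mathcal{B}):\mathcal{B}\in\mathcal{Q}(\mathcal{A})\}$. *)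

theory Defs
  imports Complex_Main
begin

text \<open>A real tensor of shape \<open>ns = [n\<^sub>1, \<dots>, n\<^sub>k]\<close> is a function on multi-indices (lists of
  naturals, 0-based) that vanishes outside the index set of its shape, so that equality of
  functions is equality of tensors.\<close>

type_synonym tensor = "nat list \<Rightarrow> real"

definition indices :: "nat list \<Rightarrow> nat list set" where
  "indices ns = {is. list_all2 (<) is ns}"

definition tensors :: "nat list \<Rightarrow> tensor set" where
  "tensors ns = {A. \<forall>is. is \<notin> indices ns \<longrightarrow> A is = 0}"

definition sgn_tensor :: "tensor \<Rightarrow> tensor" where
  "sgn_tensor A = (\<lambda>is. sgn (A is))"

definition sign_class :: "nat list \<Rightarrow> tensor \<Rightarrow> tensor set" where
  "sign_class ns A = {B \<in> tensors ns. sgn_tensor B = sgn_tensor A}"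

text \<open>The vector \<open>\<alpha> j\<close> lives in \<open>\<real>\<close> to the power \<open>ns ! j\<close>: only its first \<open>ns ! j\<close>
  entries matter, both for the product and for being nonzero.\<close>

definition outer_product :: "nat list \<Rightarrow> (nat \<Rightarrow> nat \<Rightarrow> real) \<Rightarrow> tensor" where
  "outer_product ns \<alpha> =
     (\<lambda>is. if is \<in> indices ns then (\<Prod>j<length ns. \<alpha> j (is ! j)) else 0)"

definition rank_one :: "nat list \<Rightarrow> tensor \<Rightarrow> bool" where
  "rank_one ns A \<longleftrightarrow>
     (\<exists>\<alpha>. (\<forall>j<length ns. \<exists>i<ns ! j. \<alpha> j i \<noteq> 0) \<and> A = outer_product ns \<alpha>)"

definition sum_of_rank_ones :: "nat list \<Rightarrow> tensor \<Rightarrow> nat \<Rightarrow> bool" where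
  "sum_of_rank_ones ns A r \<longleftrightarrow>
     (\<exists>T. (\<forall>j<r. rank_one ns (T j)) \<and> A = (\<lambda>is. \<Sum>j<r. T j is))"

definition tensor_rank :: "nat list \<Rightarrow> tensor \<Rightarrow> nat" where
  "tensor_rank ns A = (LEAST r. sum_of_rank_ones ns A r)"

definition mr :: "nat list \<Rightarrow> tensor \<Rightarrow> nat" where
  "mr ns A = Min (tensor_rank ns ` sign_class ns A)"

definition Mr :: "nat list \<Rightarrow> tensor \<Rightarrow> nat" where
  "Mr ns A = Max (tensor_rank ns ` sign_class ns A)"

definition slice :: "tensor \<Rightarrow> nat \<Rightarrow> tensor" where
  "slice A i = (\<lambda>is. A (i # is))"

text \<open>The tensor \<open>(S 0, \<dots>, S (m - 1))\<close> with the given slices along the first index.\<close>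

definition stack :: "nat \<Rightarrow> (nat \<Rightarrow> tensor) \<Rightarrow> tensor" where
  "stack m S = (\<lambda>is. case is of [] \<Rightarrow> 0 | i # js \<Rightarrow> if i < m then S i js else 0)"

lemma slice_in_tensors:
  assumes "A \<in> tensors (n # ms)" "i < n"
  shows "slice A i \<in> tensors ms"
  using assms by (simp add: tensors_def slice_def indices_def)

lemma stack_in_tensors:
  assumes "\<And>i. i < m \<Longrightarrow> S i \<in> tensors ms"
  shows "stack m S \<in> tensors (m # ms)"
  using assms by (auto simp: tensors_def stack_def indices_def split: list.split)

lemma stack_slices:
  assumes "A \<in> tensors (n # ms)"
  shows "stack n (slice A) = A"
proof
  fix "is"
  show "stack n (slice A) is = A is"
    using assms by (cases "is") (auto simp: tensors_def stack_def slice_def indices_def)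
qed

text \<open>For order at least one the rank is well defined and bounded by the number of entries,
  so the minimum and maximum in \<open>mr\<close> and \<open>Mr\<close> range over finite nonempty sets. (A sum of
  empty outer products is a natural number, so rank is not meaningful at order zero; it is
  never used there.)\<close>

lemma finite_indices: "finite (indices ns)"
proof (induction ns)
  case Nil
  then show ?case by (simp add: indices_def)
next
  case (Cons n ns)
  have "indices (n # ns) \<subseteq> (\<lambda>(i, js). i # js) ` ({..<n} \<times> indices ns)"
    by (auto simp: indices_def list_all2_Cons2)
  with Cons show ?case by (meson finite_SigmaI finite_imageI finite_lessThan finite_subset)
qed

lemma rank_one_single_entry:
  assumes "ns \<noteq> []" "ks \<in> indices ns" "x \<noteq> 0"
  shows "rank_one ns (\<lambda>is. if is = ks then x else 0)"
proof -
  define \<alpha> where "\<alpha> = (\<lambda>j i. if i = ks ! j then (if j = 0 then x else 1) else (0::real))"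
  have len: "length is = length ns" if "is \<in> indices ns" for "is"
    using that by (auto simp: indices_def dest: list_all2_lengthD)
  have "\<forall>j<length ns. \<exists>i<ns ! j. \<alpha> j i \<noteq> 0"
    using assms(2,3) len[OF assms(2)] unfolding \<alpha>_def indices_def
    by (auto simp: list_all2_conv_all_nth intro!: exI)
  moreover have "(if is = ks then x else 0) = outer_product ns \<alpha> is" for "is"
  proof (cases "is \<in> indices ns")
    case False
    then show ?thesis using assms(2) by (auto simp: outer_product_def)
  next
    case inI: True
    show ?thesis
    proof (cases "is = ks")
      case True
      have "(\<Prod>j<length ns. \<alpha> j (ks ! j)) = (\<Prod>j<length ns. if j = 0 then x else 1)"
        by (simp add: \<alpha>_def)
      also have "\<dots> = x" using assms(1) by (simp add: prod.delta)
      finally show ?thesis using True inI by (simp add: outer_product_def)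
    next
      case False
      then obtain j where "j < length ns" "is ! j \<noteq> ks ! j"
        using len[OF inI] len[OF assms(2)] by (metis nth_equalityI)
      then have "(\<Prod>j<length ns. \<alpha> j (is ! j)) = 0"
        by (intro prod_zero bexI[of _ j]) (auto simp: \<alpha>_def)
      then show ?thesis using False by (simp add: outer_product_def)
    qed
  qed
  ultimately show ?thesis unfolding rank_one_def by blast
qed

lemma rank_decomposition_exists:
  assumes "ns \<noteq> []" "A \<in> tensors ns"
  shows "\<exists>r \<le> card (indices ns). sum_of_rank_ones ns A r"
proof -
  let ?S = "{is \<in> indices ns. A is \<noteq> 0}"
  have fin: "finite ?S" using finite_indices by simp
  obtain f where f: "bij_betw f {..<card ?S} ?S"
    using ex_bij_betw_nat_finite[OF fin] by (auto simp: atLeast0LessThan)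
  define T where "T = (\<lambda>j is. if is = f j then A (f j) else 0)"
  have "rank_one ns (T j)" if "j < card ?S" for j
  proof -
    have "f j \<in> ?S" using f that by (auto simp: bij_betw_def)
    then show ?thesis unfolding T_def using rank_one_single_entry[OF assms(1)] by blast
  qed
  moreover have "A is = (\<Sum>j<card ?S. T j is)" for "is"
  proof -
    have "(\<Sum>j<card ?S. T j is) = (\<Sum>ks\<in>?S. if is = ks then A ks else 0)"
      unfolding T_def by (rule sum.reindex_bij_betw[OF f])
    also have "\<dots> = A is" using fin assms(2) by (auto simp: tensors_def)
    finally show ?thesis by simp
  qed
  ultimately have "sum_of_rank_ones ns A (card ?S)" unfolding sum_of_rank_ones_def by blast
  moreover have "card ?S \<le> card (indices ns)" by (intro card_mono finite_indices) auto
  ultimately show ?thesis by blast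
qed

lemma tensor_rank_decomposition:
  assumes "ns \<noteq> []" "A \<in> tensors ns"
  shows "sum_of_rank_ones ns A (tensor_rank ns A)"
  using rank_decomposition_exists[OF assms] unfolding tensor_rank_def by (meson LeastI)

lemma finite_ranks:
  assumes "ns \<noteq> []"
  shows "finite (tensor_rank ns ` sign_class ns A)"
proof (rule finite_subset)
  show "tensor_rank ns ` sign_class ns A \<subseteq> {..card (indices ns)}"
    using rank_decomposition_exists[OF assms]
    by (fastforce simp: sign_class_def tensor_rank_def intro: order_trans[OF Least_le])
qed simp

lemma ranks_nonempty:
  assumes "A \<in> tensors ns"
  shows "tensor_rank ns ` sign_class ns A \<noteq> {}"
  using assms by (auto simp: sign_class_def)

end

theory Submission
  imports Defs
begin

text \<open>Replacing the slices along the first index by scalar multiples of these slices, possibly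
  with repetitions, acts only on the first vector of every rank one term and hence does not
  increase the rank. Deleting the last slice is such an operation, and so is appending a zero slice
  or \<open>\<plusminus>\<close> a copy of another slice. Both directions are compatible with the sign patterns, which gives
  the equality of the minimum ranks; if the last slice is zero, the two operations are mutually
  inverse on the sign classes, which gives the equality of the maximum ranks.\<close>

section \<open>Rank bounds from sums of outer products\<close>

text \<open>Failing to be rank one forces some vector to vanish on its whole range, so every entry
  contains a zero factor.\<close>

lemma outer_product_not_rank_one:
  assumes "\<not> rank_one ns (outer_product ns \<alpha>)"
  shows "outer_product ns \<alpha> = (\<lambda>is. 0)"
proof
  fix "is"
  obtain j where j: "j < length ns" "\<forall>i<ns ! j. \<alpha> j i = 0"
    using assms unfolding rank_one_def by blast
  show "outer_product ns \<alpha> is = 0"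
  proof (cases "is \<in> indices ns")
    case True
    then have "\<alpha> j (is ! j) = 0"
      using j by (auto simp: indices_def list_all2_conv_all_nth)
    then have "(\<Prod>j<length ns. \<alpha> j (is ! j)) = 0"
      using j(1) by (intro prod_zero) auto
    then show ?thesis by (simp add: outer_product_def)
  qed (simp add: outer_product_def)
qed

text \<open>Terms with a zero vector contribute nothing and are discarded one by one. This permits
  rank bounds from decompositions whose terms may degenerate to zero.\<close>

lemma sum_outer_products_drop_zeros:
  "\<exists>r'\<le>r. sum_of_rank_ones ns (\<lambda>is. \<Sum>j<r. outer_product ns (\<alpha> j) is) r'"
proof (induction r)
  case 0
  show ?case by (auto simp: sum_of_rank_ones_def)
next
  case (Suc r)
  then obtain r' T where r': "r' \<le> r" and T: "\<forall>j<r'. rank_one ns (T j)"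
    and eq: "(\<lambda>is. \<Sum>j<r. outer_product ns (\<alpha> j) is) = (\<lambda>is. \<Sum>j<r'. T j is)"
    unfolding sum_of_rank_ones_def by blast
  note eq' = fun_cong[OF eq]
  show ?case
  proof (cases "rank_one ns (outer_product ns (\<alpha> r))")
    case True
    let ?T = "T(r' := outer_product ns (\<alpha> r))"
    have "(\<Sum>j<Suc r'. ?T j is) = (\<Sum>j<Suc r. outer_product ns (\<alpha> j) is)" for "is"
      by (simp add: eq')
    moreover have "\<forall>j<Suc r'. rank_one ns (?T j)"
      using T True by (simp add: less_Suc_eq)
    ultimately have "sum_of_rank_ones ns (\<lambda>is. \<Sum>j<Suc r. outer_product ns (\<alpha> j) is) (Suc r')"
      unfolding sum_of_rank_ones_def by metis
    with r' show ?thesis by (meson Suc_le_mono)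
  next
    case False
    have "(\<lambda>is. \<Sum>j<Suc r. outer_product ns (\<alpha> j) is) = (\<lambda>is. \<Sum>j<r'. T j is)"
      by (simp add: outer_product_not_rank_one[OF False] eq')
    with T r' show ?thesis unfolding sum_of_rank_ones_def by (metis le_SucI)
  qed
qed

lemma tensor_rank_le_sum_outer_products:
  "tensor_rank ns (\<lambda>is. \<Sum>j<r. outer_product ns (\<alpha> j) is) \<le> r"
  using sum_outer_products_drop_zeros[of r ns \<alpha>] unfolding tensor_rank_def
  by (meson Least_le order_trans)

lemma tensor_rank_outer_products:
  assumes "ns \<noteq> []" "B \<in> tensors ns"
  obtains \<alpha> where "B = (\<lambda>is. \<Sum>j<tensor_rank ns B. outer_product ns (\<alpha> j) is)"
proof -
  obtain T where T: "\<forall>j<tensor_rank ns B. rank_one ns (T j)"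
    and B: "B = (\<lambda>is. \<Sum>j<tensor_rank ns B. T j is)"
    using tensor_rank_decomposition[OF assms] unfolding sum_of_rank_ones_def by blast
  from T have "\<forall>j<tensor_rank ns B. \<exists>\<alpha>. T j = outer_product ns \<alpha>"
    unfolding rank_one_def by blast
  then obtain \<alpha> where "\<forall>j<tensor_rank ns B. T j = outer_product ns (\<alpha> j)"
    by metis
  then have "(\<lambda>is. \<Sum>j<tensor_rank ns B. T j is)
    = (\<lambda>is. \<Sum>j<tensor_rank ns B. outer_product ns (\<alpha> j) is)"
    by (intro ext sum.cong) auto
  with B show ?thesis by (intro that) simp
qed

section \<open>Rescaling and selecting slices along the first index\<close>

text \<open>This is multiplication along the first mode by a matrix with at most one nonzero entry
  per row. It covers deleting, copying, negating and zeroing slices at once, and no entries are ever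
  added, so signs stay under control.\<close>

definition resample :: "nat \<Rightarrow> (nat \<Rightarrow> real) \<Rightarrow> (nat \<Rightarrow> nat) \<Rightarrow> tensor \<Rightarrow> tensor" where
  "resample m d f B = stack m (\<lambda>i js. d i * slice B (f i) js)"

lemma resample_simps [simp]:
  "resample m d f B [] = 0"
  "resample m d f B (i # js) = (if i < m then d i * B (f i # js) else 0)"
  by (simp_all add: resample_def stack_def slice_def)

lemma Cons_in_indices [simp]: "i # js \<in> indices (n # ms) \<longleftrightarrow> i < n \<and> js \<in> indices ms"
  by (simp add: indices_def)

lemma Nil_notin_indices [simp]: "[] \<notin> indices (n # ms)"
  by (simp add: indices_def)

lemma resample_outer_product:
  assumes "\<And>i. i < m \<Longrightarrow> f i < n"
  shows "resample m d f (outer_product (n # ms) \<alpha>)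
    = outer_product (m # ms) (\<alpha>(0 := \<lambda>i. d i * \<alpha> 0 (f i)))"
proof
  fix "is"
  show "resample m d f (outer_product (n # ms) \<alpha>) is
    = outer_product (m # ms) (\<alpha>(0 := \<lambda>i. d i * \<alpha> 0 (f i))) is"
    \<comment> \<open>The factor \<open>j = 0\<close> must be split off the product, since only the
      first vector changes; the default rule would split off the last one.\<close>
    using assms by (cases "is") (auto simp: outer_product_def prod.lessThan_Suc_shift simp del: prod.lessThan_Suc)
qed

lemma resample_sum:
  "resample m d f (\<lambda>is. \<Sum>j<r. T j is) = (\<lambda>is. \<Sum>j<r. resample m d f (T j) is)"
proof
  fix "is"
  show "resample m d f (\<lambda>is. \<Sum>j<r. T j is) is = (\<Sum>j<r. resample m d f (T j) is)"
    by (cases "is") (auto simp: sum_distrib_left)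
qed

text \<open>A minimal decomposition is transformed term by term. The new first vectors may be zero,
  so the bound goes through outer products instead of rank one tensors.\<close>

lemma tensor_rank_resample_le:
  assumes "B \<in> tensors (n # ms)" "\<And>i. i < m \<Longrightarrow> f i < n"
  shows "tensor_rank (m # ms) (resample m d f B) \<le> tensor_rank (n # ms) B"
proof -
  let ?r = "tensor_rank (n # ms) B"
  obtain \<alpha> where B: "B = (\<lambda>is. \<Sum>j<?r. outer_product (n # ms) (\<alpha> j) is)"
    using tensor_rank_outer_products[OF _ assms(1)] by blast
  define \<beta> where "\<beta> j = (\<alpha> j)(0 := \<lambda>i. d i * \<alpha> j 0 (f i))" for j
  have "resample m d f B = resample m d f (\<lambda>is. \<Sum>j<?r. outer_product (n # ms) (\<alpha> j) is)"
    using B by simp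
  also have "\<dots> = (\<lambda>is. \<Sum>j<?r. outer_product (m # ms) (\<beta> j) is)"
    using assms(2) by (simp add: resample_sum resample_outer_product \<beta>_def)
  finally show ?thesis using tensor_rank_le_sum_outer_products by simp
qed

section \<open>Sign classes and extremal ranks\<close>

lemma sign_class_iff:
  "B \<in> sign_class ns A \<longleftrightarrow> B \<in> tensors ns \<and> (\<forall>is. sgn (B is) = sgn (A is))"
  by (auto simp: sign_class_def sgn_tensor_def fun_eq_iff)

lemma resample_sign_class:
  assumes "B \<in> sign_class (n # ms) A" "\<And>i. i < m \<Longrightarrow> f i < n"
  shows "resample m d f B \<in> sign_class (m # ms) (resample m d f A)"
proof -
  have "sgn (resample m d f B is) = sgn (resample m d f A is)" for "is"
    using assms by (cases "is") (auto simp: sign_class_iff sgn_mult)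
  moreover have "resample m d f B \<in> tensors (m # ms)"
    unfolding resample_def using assms
    by (intro stack_in_tensors) (auto simp: sign_class_iff tensors_def slice_def)
  ultimately show ?thesis by (simp add: sign_class_iff)
qed

lemma sign_class_cong: "(\<And>is. sgn (A is) = sgn (A' is)) \<Longrightarrow> sign_class ns A = sign_class ns A'"
  by (simp add: sign_class_def sgn_tensor_def)

lemma mr_le:
  assumes "ns \<noteq> []" "B \<in> sign_class ns A"
  shows "mr ns A \<le> tensor_rank ns B"
  unfolding mr_def using assms finite_ranks by (intro Min_le) auto

lemma Mr_ge:
  assumes "ns \<noteq> []" "B \<in> sign_class ns A"
  shows "tensor_rank ns B \<le> Mr ns A"
  unfolding Mr_def using assms finite_ranks by (intro Max_ge) auto

lemma mr_attained:
  assumes "ns \<noteq> []" "A \<in> tensors ns"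
  obtains B where "B \<in> sign_class ns A" "tensor_rank ns B = mr ns A"
  using Min_in[OF finite_ranks ranks_nonempty, OF assms] unfolding mr_def by auto

lemma Mr_attained:
  assumes "ns \<noteq> []" "A \<in> tensors ns"
  obtains B where "B \<in> sign_class ns A" "tensor_rank ns B = Mr ns A"
  using Max_in[OF finite_ranks ranks_nonempty, OF assms] unfolding Mr_def by auto

lemma mr_resample_le:
  assumes "A \<in> tensors (n # ms)" "\<And>i. i < m \<Longrightarrow> f i < n"
  shows "mr (m # ms) (resample m d f A) \<le> mr (n # ms) A"
proof -
  obtain B where B: "B \<in> sign_class (n # ms) A" "tensor_rank (n # ms) B = mr (n # ms) A"
    using mr_attained[OF _ assms(1)] by blast
  have "mr (m # ms) (resample m d f A) \<le> tensor_rank (m # ms) (resample m d f B)"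
    using resample_sign_class[OF B(1) assms(2)] by (simp add: mr_le)
  also have "\<dots> \<le> tensor_rank (n # ms) B"
    using B(1) assms(2) by (intro tensor_rank_resample_le) (auto simp: sign_class_iff)
  finally show ?thesis using B(2) by simp
qed

text \<open>For the maximum, a maximizer must not lose rank under the operation. It is recovered
  from its image by another such operation, which cannot increase rank either.\<close>

lemma Mr_le_resample:
  assumes "A \<in> tensors (n # ms)" "\<And>i. i < m \<Longrightarrow> f i < n" "\<And>i. i < n \<Longrightarrow> g i < m"
    and inverse: "\<And>B. B \<in> sign_class (n # ms) A \<Longrightarrow> resample n e g (resample m d f B) = B"
  shows "Mr (n # ms) A \<le> Mr (m # ms) (resample m d f A)"
proof -
  obtain B where B: "B \<in> sign_class (n # ms) A" "tensor_rank (n # ms) B = Mr (n # ms) A"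
    using Mr_attained[OF _ assms(1)] by blast
  have C: "resample m d f B \<in> sign_class (m # ms) (resample m d f A)"
    using resample_sign_class[OF B(1) assms(2)] .
  have "tensor_rank (n # ms) B = tensor_rank (n # ms) (resample n e g (resample m d f B))"
    using inverse[OF B(1)] by simp
  also have "\<dots> \<le> tensor_rank (m # ms) (resample m d f B)"
    using C assms(3) by (intro tensor_rank_resample_le) (auto simp: sign_class_iff)
  also have "\<dots> \<le> Mr (m # ms) (resample m d f A)"
    using C by (simp add: Mr_ge)
  finally show ?thesis using B(2) by simp
qed

section \<open>Deleting the last slice\<close>

text \<open>The real \<open>c\<close> is arbitrary, so that \<open>c = 0\<close> covers a zero last
  slice and \<open>c = 1\<close> or \<open>c = -1\<close> a repeated sign pattern.\<close>

lemma mr_drop_proportional_slice: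
  assumes A: "A \<in> tensors (Suc p # ms)" and l: "l < p"
    and sgn: "\<And>js. sgn (A (p # js)) = sgn (c * A (l # js))"
  shows "mr (Suc p # ms) A = mr (p # ms) (stack p (slice A))"
proof (rule antisym)
  let ?A1 = "stack p (slice A)"
  let ?d = "\<lambda>i. if i < p then 1 else c" and ?f = "\<lambda>i. if i < p then i else l"
  have A1: "?A1 \<in> tensors (p # ms)"
    using A slice_in_tensors by (intro stack_in_tensors) auto
  \<comment> \<open>The extension of \<open>?A1\<close> may differ from \<open>A\<close> in its last
    slice, but it has the same signs, and \<open>mr\<close> depends only on the sign class.\<close>
  have "sgn (A is) = sgn (resample (Suc p) ?d ?f ?A1 is)" for "is"
    using A l sgn
    by (cases "is") (auto simp: stack_def slice_def tensors_def less_Suc_eq)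
  then have "mr (Suc p # ms) A = mr (Suc p # ms) (resample (Suc p) ?d ?f ?A1)"
    unfolding mr_def by (simp cong: sign_class_cong)
  also have "\<dots> \<le> mr (p # ms) ?A1"
    using A1 l by (intro mr_resample_le) auto
  finally show "mr (Suc p # ms) A \<le> mr (p # ms) ?A1" .
  have "mr (p # ms) (resample p (\<lambda>_. 1) (\<lambda>i. i) A) \<le> mr (Suc p # ms) A"
    using A by (intro mr_resample_le) auto
  then show "mr (p # ms) ?A1 \<le> mr (Suc p # ms) A"
    by (simp add: resample_def)
qed

lemma Mr_drop_zero_slice:
  assumes A: "A \<in> tensors (Suc p # ms)" and "0 < p" and zero: "slice A p = (\<lambda>is. 0)"
  shows "Mr (Suc p # ms) A = Mr (p # ms) (stack p (slice A))"
proof (rule antisym)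
  let ?A1 = "stack p (slice A)"
  let ?R = "resample p (\<lambda>_. 1) (\<lambda>i. i)"
  \<comment> \<open>The multiplier 0 creates the zero slice; its source index 0 is a default, valid
    because \<open>0 < p\<close>.\<close>
  let ?E = "resample (Suc p) (\<lambda>i. if i < p then 1 else 0) (\<lambda>i. if i < p then i else 0)"
  have A1: "?A1 \<in> tensors (p # ms)"
    using A slice_in_tensors by (intro stack_in_tensors) auto
  have RA: "?R A = ?A1" by (simp add: resample_def)
  have zero': "A (p # js) = 0" for js
    using fun_cong[OF zero, of js] by (simp add: slice_def)
  have ER: "?E (?R B) = B" if B: "B \<in> sign_class (Suc p # ms) A" for B
  proof
    fix "is"
    \<comment> \<open>Sign zero forces value zero, so deleting the last slice loses no information
      on the whole sign class.\<close>
    have "B (p # js) = 0" for js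
      using B zero'[of js] unfolding sign_class_iff by (metis sgn_0_0)
    then show "?E (?R B) is = B is"
      using B by (cases "is") (auto simp: sign_class_iff tensors_def less_Suc_eq)
  qed
  have RE: "?R (?E B) = B" if "B \<in> tensors (p # ms)" for B
  proof
    fix "is"
    show "?R (?E B) is = B is"
      using that by (cases "is") (auto simp: tensors_def)
  qed
  have "Mr (Suc p # ms) A \<le> Mr (p # ms) (?R A)"
    using A \<open>0 < p\<close> by (intro Mr_le_resample[OF _ _ _ ER]) auto
  then show "Mr (Suc p # ms) A \<le> Mr (p # ms) ?A1" by (simp only: RA)
  have "Mr (p # ms) ?A1 \<le> Mr (Suc p # ms) (?E ?A1)"
    using A1 \<open>0 < p\<close> by (intro Mr_le_resample[OF _ _ _ RE]) (auto simp: sign_class_iff)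
  moreover have "?E ?A1 = A"
    using ER[of A] A unfolding RA by (simp add: sign_class_iff)
  ultimately show "Mr (p # ms) ?A1 \<le> Mr (Suc p # ms) A"
    by simp
qed

theorem theorem3p2:
  fixes n :: nat and ms :: "nat list" and A :: tensor
  assumes "2 \<le> n"
    and "\<forall>m\<in>set ms. 1 \<le> m"
    and "A \<in> tensors (n # ms)"
  shows "let A1 = stack (n - 1) (slice A) in
         (slice A (n - 1) = (\<lambda>is. 0) \<longrightarrow>
            mr (n # ms) A = mr ((n - 1) # ms) A1 \<and> Mr (n # ms) A = Mr ((n - 1) # ms) A1) \<and>
         ((\<exists>l<n - 1. \<exists>c\<in>{1, -1}.
            sgn_tensor (slice A (n - 1)) = (\<lambda>is. c * sgn_tensor (slice A l) is)) \<longrightarrow>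
            mr (n # ms) A = mr ((n - 1) # ms) A1)"
proof -
  define p where "p = n - 1"
  have n: "n = Suc p" and "0 < p" using assms(1) by (simp_all add: p_def)
  have A: "A \<in> tensors (Suc p # ms)" using assms(3) n by simp
  have "mr (Suc p # ms) A = mr (p # ms) (stack p (slice A))"
    if "l < p" "c \<in> {1, -1}"
      and sgn: "sgn_tensor (slice A p) = (\<lambda>is. c * sgn_tensor (slice A l) is)" for l and c :: real
  proof (rule mr_drop_proportional_slice[OF A \<open>l < p\<close>])
    show "sgn (A (p # js)) = sgn (c * A (l # js))" for js
      using fun_cong[OF sgn, of js] \<open>c \<in> {1, -1}\<close>
      by (auto simp: sgn_tensor_def slice_def sgn_mult)
  qed
  moreover have "mr (Suc p # ms) A = mr (p # ms) (stack p (slice A))"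
    if zero: "slice A p = (\<lambda>is. 0)"
  proof (rule mr_drop_proportional_slice[OF A \<open>0 < p\<close>])
    \<comment> \<open>A zero slice is 0 times slice 0, which survives the deletion since
      \<open>2 \<le> n\<close>.\<close>
    show "sgn (A (p # js)) = sgn (0 * A (0 # js))" for js
      using fun_cong[OF zero, of js] by (simp add: slice_def)
  qed
  ultimately show ?thesis
    unfolding Let_def n diff_Suc_1 using Mr_drop_zero_slice[OF A \<open>0 < p\<close>] by blast
qed

end
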